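(* Let $R$ be an integral domain, let $S\subseteq R$ be a multiplicatively closed subset, and suppose $R$ is $S$-Noetherian. Let $I$ be an ideal of $R$ with $I\cap S=\emptyset$, and let $B=\bigcap_{n=1}^{\infty}I^{n}$. Then there exists $t\in S$ such that $tB=0$.
   Context: A multiplicatively closed subset $S$ of a commutative ring $R$ is a subset with $1\in S$, $0\notin S$, and $st\in S$ for all $s,t\in S$. The ring $R$ is $S$-Noetherian if for every ideal $I$ of $R$ there exist $s\in S$ and a finitely generated ideal $J$ of $R$ such that $sI\subseteq J\subseteq I$. *)

theory Defs
  imports "HOL-Algebra.Algebra"
begin

definition mult_closed_subset :: "('a, 'b) ring_scheme \<Rightarrow> 'a set \<Rightarrow> bool" where
  "mult_closed_subset R S \<longleftrightarrow> submonoid S R \<and> \<zero>\<^bsub>R\<^esub> \<notin> S"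

definition fin_gen_ideal :: "('a, 'b) ring_scheme \<Rightarrow> 'a set \<Rightarrow> bool" where
  "fin_gen_ideal R J \<longleftrightarrow> (\<exists>A \<subseteq> carrier R. finite A \<and> J = Idl\<^bsub>R\<^esub> A)"

text \<open>The library's left coset \<open>s <#\<^bsub>R\<^esub> I\<close> is taken with respect to the multiplication of \<open>R\<close>
  (not its addition), so it is the set \<open>s I\<close> of all products of \<open>s\<close> with an element of \<open>I\<close>.\<close>

definition S_Noetherian :: "('a, 'b) ring_scheme \<Rightarrow> 'a set \<Rightarrow> bool" where
  "S_Noetherian R S \<longleftrightarrow>
     (\<forall>I. ideal I R \<longrightarrow>
        (\<exists>s \<in> S. \<exists>J. fin_gen_ideal R J \<and> s <#\<^bsub>R\<^esub> I \<subseteq> J \<and> J \<subseteq> I))"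

text \<open>Powers are taken in the library's semiring \<^const>\<open>ideals_set\<close> of ideals, whose multiplication
  is the ideal product \<^const>\<open>ideal_prod\<close> (finite sums of products), not the elementwise one.\<close>

abbreviation ideal_power :: "('a, 'b) ring_scheme \<Rightarrow> 'a set \<Rightarrow> nat \<Rightarrow> 'a set" where
  "ideal_power R I n \<equiv> I [^]\<^bsub>ideals_set R\<^esub> n"

end

theory Submission
  imports Defs
begin

text \<open>
  The intersection \<open>B\<close> is in fact zero, so \<open>t = 1\<close> works. After inverting \<open>S\<close> this is Krull's
  intersection theorem for a proper ideal of a Noetherian domain; here the elements of \<open>S\<close> are
  carried along as explicit factors.

  Suppose \<open>b \<in> B\<close> is nonzero. It suffices to find an ideal \<open>K\<close> that contains a power of \<open>I\<close>, up to
  multiplication by elements of \<open>S\<close>, and yet satisfies \<open>K \<inter> (b) \<subseteq> b I\<close>, again up to elements of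
  \<open>S\<close>. Indeed, \<open>b\<close> lies in every power of \<open>I\<close>, so \<open>u b \<in> K\<close> for some \<open>u \<in> S\<close>, and then
  \<open>v u b \<in> b I\<close> for some \<open>v \<in> S\<close>; cancelling \<open>b\<close> puts \<open>v u\<close> into \<open>I \<inter> S\<close>, which is empty.

  Such a \<open>K\<close> is built from \<open>b I\<close> (\<open>bounded_trace_scaled_ideal\<close>) by adjoining powers of
  elements \<open>a \<in> I\<close>. A sufficiently high power of \<open>a\<close> does not enlarge the intersection with \<open>(b)\<close>
  beyond \<open>b I\<close> (\<open>bounded_trace_add_power\<close>), because the colon ideals \<open>K : a\<^sup>m\<close> stabilize up to a
  factor in \<open>S\<close> (\<open>S_Noetherian_colon_powers_stabilize\<close>). Since \<open>I\<close> itself need not be finitely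
  generated, this is done for the generators of a finitely generated ideal \<open>J\<close> with
  \<open>s I \<subseteq> J \<subseteq> I\<close>; finitely many steps capture a power \<open>J\<^sup>N\<close>
  (\<open>bounded_trace_contains_power\<close>), which contains \<open>s\<^sup>N I\<^sup>N\<close> (\<open>ideal_power_scale\<close>).
\<close>

section \<open>Ideals and their powers in a commutative ring\<close>

context cring
begin

lemma idealI_cring:
  assumes "I \<subseteq> carrier R" and "\<zero> \<in> I"
    and add: "\<And>x y. x \<in> I \<Longrightarrow> y \<in> I \<Longrightarrow> x \<oplus> y \<in> I"
    and mult: "\<And>r x. r \<in> carrier R \<Longrightarrow> x \<in> I \<Longrightarrow> r \<otimes> x \<in> I"
  shows "ideal I R"
proof (rule idealI)
  show "ring R" by (rule ring_axioms)
  show "subgroup I (add_monoid R)"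
  proof (rule subgroup.intro)
    fix x assume x: "x \<in> I"
    have "\<ominus> x = (\<ominus> \<one>) \<otimes> x"
      using x assms(1) by (auto simp: l_minus)
    then show "inv\<^bsub>add_monoid R\<^esub> x \<in> I"
      using mult[OF _ x, of "\<ominus> \<one>"] by (simp add: a_inv_def)
  qed (use assms in auto)
  show "r \<otimes> x \<in> I" if "x \<in> I" "r \<in> carrier R" for x r
    using mult that by blast
  show "x \<otimes> r \<in> I" if "x \<in> I" "r \<in> carrier R" for x r
    using mult that assms(1) m_comm by (metis subsetD)
qed

lemma ideal_sum_closed:
  assumes "ideal K R" "x \<in> K" "y \<in> K"
  shows "x \<oplus> y \<in> K"
  using assms by (simp add: additive_subgroup.a_closed ideal.axioms(1))

lemma colon_ideal:
  assumes "ideal K R" "c \<in> carrier R"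
  shows "ideal {x \<in> carrier R. c \<otimes> x \<in> K} R"
proof (rule idealI_cring)
  interpret K: ideal K R by fact
  fix r x assume r: "r \<in> carrier R" and x: "x \<in> {x \<in> carrier R. c \<otimes> x \<in> K}"
  then have "c \<otimes> (r \<otimes> x) = r \<otimes> (c \<otimes> x)"
    using assms(2) by (simp add: m_lcomm)
  then show "r \<otimes> x \<in> {x \<in> carrier R. c \<otimes> x \<in> K}"
    using r x K.I_l_closed by auto
qed (use assms ideal_sum_closed in \<open>auto simp: r_distr additive_subgroup.zero_closed ideal.axioms(1)\<close>)

lemma nat_pow_mult_mem_mono:
  assumes "ideal K R" "a \<in> carrier R" "x \<in> carrier R" "a [^] (m::nat) \<otimes> x \<in> K" "m \<le> n"
  shows "a [^] n \<otimes> x \<in> K"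
proof -
  have "a [^] n = a [^] (n - m) \<otimes> a [^] m"
    using assms(2,5) by (simp add: nat_pow_mult)
  then have "a [^] n \<otimes> x = a [^] (n - m) \<otimes> (a [^] m \<otimes> x)"
    using assms(2,3) by (simp add: m_assoc)
  then show ?thesis
    using assms by (simp add: ideal.I_l_closed)
qed

lemma ideals_set_one [simp]: "\<one>\<^bsub>ideals_set R\<^esub> = carrier R"
  by (simp add: ideals_set_def)

lemma ideal_power_0: "ideal_power R I 0 = carrier R"
  by (simp add: nat_pow_def ideals_set_def)

lemma ideal_power_Suc: "ideal_power R I (Suc n) = ideal_power R I n \<cdot> I"
  by (simp add: nat_pow_def ideals_set_def)

lemma ideal_power_ideal:
  assumes "ideal I R"
  shows "ideal (ideal_power R I n) R"
  by (induction n) (simp_all only: ideal_power_0 ideal_power_Suc oneideal ideal_prod_is_ideal assms)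

lemma ideal_prod_subsetI:
  assumes "ideal K R" and "\<And>x y. x \<in> I \<Longrightarrow> y \<in> J \<Longrightarrow> x \<otimes> y \<in> K"
  shows "I \<cdot> J \<subseteq> K"
proof
  fix z assume "z \<in> I \<cdot> J"
  then show "z \<in> K"
    by induction (use assms ideal_sum_closed in auto)
qed

lemma ideal_power_mono:
  assumes "I \<subseteq> J"
  shows "ideal_power R I n \<subseteq> ideal_power R J n"
proof (induction n)
  case (Suc n)
  have "x \<in> ideal_power R J n \<cdot> J" if "x \<in> ideal_power R I n \<cdot> I" for x
    using that by induction (use Suc assms in \<open>auto intro: ideal_prod.intros\<close>)
  then show ?case
    by (auto simp only: ideal_power_Suc)
qed (simp add: ideal_power_0)

text \<open>By the binomial expansion, each term of a product of \<open>p + q\<close> factors from \<open>J + P\<close> has at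
  least \<open>p\<close> factors from \<open>J\<close> or at least \<open>q\<close> factors from \<open>P\<close>.\<close>

lemma ideal_power_add_subset:
  assumes J: "ideal J R" and P: "ideal P R"
  shows "ideal_power R (J <+> P) (p + q) \<subseteq> ideal_power R J p <+> ideal_power R P q"
proof (induction "p + q" arbitrary: p q)
  case 0
  then show ?case
    by (auto simp: ideal_power_0 set_add_def' intro: bexI[of _ \<zero>])
next
  case (Suc n)
  note pow = ideal_power_ideal[OF J] ideal_power_ideal[OF P]
  have sum: "ideal (ideal_power R J p <+> ideal_power R P q) R"
    using pow by (simp add: add_ideals)
  have M: "ideal (ideal_power R (J <+> P) k) R" for k
    using J P by (simp add: add_ideals ideal_power_ideal)
  have sub: "ideal_power R (J <+> P) k \<subseteq> carrier R" for k
    using ideal.Icarr[OF M] by blast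
  show ?case
  proof (cases "p = 0 \<or> q = 0")
    case True
    have "carrier R \<subseteq> ideal_power R J p <+> ideal_power R P q"
    proof
      fix x assume x: "x \<in> carrier R"
      have "\<zero> \<in> ideal_power R J p" "\<zero> \<in> ideal_power R P q"
        using pow by (simp_all add: additive_subgroup.zero_closed ideal.axioms(1))
      moreover have "x = x \<oplus> \<zero>" "x = \<zero> \<oplus> x" using x by simp_all
      ultimately show "x \<in> ideal_power R J p <+> ideal_power R P q"
        using True x unfolding set_add_def' by (metis (mono_tags, lifting) ideal_power_0 UN_I singletonI)
    qed
    then show ?thesis using sub by blast
  next
    case False
    then obtain p' q' where pq: "p = Suc p'" "q = Suc q'"
      by (meson not0_implies_Suc)
    have n: "n = p' + q" "n = p + q'" using Suc.hyps(2) pq by auto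
    have "ideal_power R (J <+> P) n \<cdot> (J <+> P) \<subseteq> ideal_power R J p <+> ideal_power R P q"
    proof (rule ideal_prod_subsetI[OF sum])
      fix x m :: 'a assume x: "x \<in> ideal_power R (J <+> P) n" and "m \<in> J <+> P"
      then obtain j y where m: "m = j \<oplus> y" "j \<in> J" "y \<in> P"
        unfolding set_add_def' by blast
      have xc: "x \<in> carrier R" and jc: "j \<in> carrier R" and yc: "y \<in> carrier R"
        using x sub m J P ideal.Icarr by (blast, fastforce+)
      obtain u v where uv: "x = u \<oplus> v" "u \<in> ideal_power R J p'" "v \<in> ideal_power R P q"
        using Suc.hyps(1)[OF n(1)] x n(1) unfolding set_add_def' by blast
      have uvc: "u \<in> carrier R" "v \<in> carrier R"
        using uv pow ideal.Icarr by fastforce+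
      have "u \<otimes> j \<in> ideal_power R J p"
        unfolding pq(1) ideal_power_Suc using uv m by (auto intro: ideal_prod.prod)
      moreover have "v \<otimes> j \<in> ideal_power R P q"
        using uv jc pow(2) by (simp add: ideal.I_r_closed)
      moreover have "x \<otimes> j = u \<otimes> j \<oplus> v \<otimes> j"
        using uv uvc jc by (simp add: l_distr)
      ultimately have 1: "x \<otimes> j \<in> ideal_power R J p <+> ideal_power R P q"
        unfolding set_add_def' by blast
      obtain u v where uv: "x = u \<oplus> v" "u \<in> ideal_power R J p" "v \<in> ideal_power R P q'"
        using Suc.hyps(1)[OF n(2)] x n(2) unfolding set_add_def' by blast
      have uvc: "u \<in> carrier R" "v \<in> carrier R"
        using uv pow ideal.Icarr by fastforce+
      have "v \<otimes> y \<in> ideal_power R P q"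
        unfolding pq(2) ideal_power_Suc using uv m by (auto intro: ideal_prod.prod)
      moreover have "u \<otimes> y \<in> ideal_power R J p"
        using uv yc pow(1) by (simp add: ideal.I_r_closed)
      moreover have "x \<otimes> y = u \<otimes> y \<oplus> v \<otimes> y"
        using uv uvc yc by (simp add: l_distr)
      ultimately have 2: "x \<otimes> y \<in> ideal_power R J p <+> ideal_power R P q"
        unfolding set_add_def' by blast
      show "x \<otimes> m \<in> ideal_power R J p <+> ideal_power R P q"
        using ideal_sum_closed[OF sum 1 2] xc jc yc m(1) by (simp add: r_distr)
    qed
    then show ?thesis
      unfolding Suc.hyps(2)[symmetric] ideal_power_Suc .
  qed
qed

lemma ideal_power_cgenideal_subset:
  assumes a: "a \<in> carrier R"
  shows "ideal_power R (PIdl a) n \<subseteq> PIdl (a [^] n)"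
proof (induction n)
  case 0
  show ?case
    unfolding ideal_power_0 by (force simp: cgenideal_def)
next
  case (Suc n)
  show ?case
    unfolding ideal_power_Suc
  proof (rule ideal_prod_subsetI)
    show "ideal (PIdl (a [^] Suc n)) R"
      using a by (intro cgenideal_ideal) simp
    fix x y assume "x \<in> ideal_power R (PIdl a) n" "y \<in> PIdl a"
    then obtain r t where rt: "x = r \<otimes> a [^] n" "y = t \<otimes> a" "r \<in> carrier R" "t \<in> carrier R"
      using Suc unfolding cgenideal_def by blast
    then have "x \<otimes> y = (r \<otimes> t) \<otimes> a [^] Suc n"
      using a by (simp add: m_ac)
    then show "x \<otimes> y \<in> PIdl (a [^] Suc n)"
      using rt unfolding cgenideal_def by blast
  qed
qed

lemma ideal_power_scale:
  assumes I: "ideal I R" and J: "ideal J R" and s: "s \<in> carrier R" and sub: "s <# I \<subseteq> J"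
    and "x \<in> ideal_power R I n"
  shows "s [^] n \<otimes> x \<in> ideal_power R J n"
proof -
  \<comment> \<open>The elements that \<open>s\<^sup>n\<close> maps into \<open>J\<^sup>n\<close> form an ideal, so products of generators suffice.\<close>
  have "ideal_power R I n \<subseteq> {x \<in> carrier R. s [^] n \<otimes> x \<in> ideal_power R J n}"
  proof (induction n)
    case 0
    show ?case by (auto simp: ideal_power_0)
  next
    case (Suc n)
    show ?case
      unfolding ideal_power_Suc[of I]
    proof (rule ideal_prod_subsetI)
      show "ideal {x \<in> carrier R. s [^] Suc n \<otimes> x \<in> ideal_power R J (Suc n)} R"
        using J s by (intro colon_ideal ideal_power_ideal nat_pow_closed)
      fix x y assume x: "x \<in> ideal_power R I n" and y: "y \<in> I"
      have c: "x \<in> carrier R" "y \<in> carrier R"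
        using x y I ideal_power_ideal ideal.Icarr by fastforce+
      have "s [^] Suc n \<otimes> (x \<otimes> y) = (s [^] n \<otimes> x) \<otimes> (s \<otimes> y)"
        using s c by (simp add: m_ac)
      moreover have "s \<otimes> y \<in> J"
        using sub y by (auto simp: l_coset_def)
      moreover have "s [^] n \<otimes> x \<in> ideal_power R J n"
        using Suc x by blast
      ultimately show "x \<otimes> y \<in> {x \<in> carrier R. s [^] Suc n \<otimes> x \<in> ideal_power R J (Suc n)}"
        using c by (auto simp only: ideal_power_Suc m_closed mem_Collect_eq intro: ideal_prod.prod)
    qed
  qed
  then show ?thesis using assms(5) by blast
qed

end


section \<open>Stabilization of colon ideals\<close>

text \<open>The ideals \<open>K : a\<^sup>m\<close> ascend, and \<open>s\<close> times their union lies in a finitely generated ideal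
  contained in the union. Each of the finitely many generators lies in some \<open>K : a\<^sup>m\<close>, hence all
  of them lie in \<open>K : a\<^sup>n\<close> for one \<open>n\<close>.\<close>

lemma (in cring) S_Noetherian_colon_powers_stabilize:
  assumes noeth: "S_Noetherian R S" and S: "S \<subseteq> carrier R"
    and K: "ideal K R" and a: "a \<in> carrier R"
  obtains s n where "s \<in> S"
    and "\<And>x m. x \<in> carrier R \<Longrightarrow> a [^] (m::nat) \<otimes> x \<in> K \<Longrightarrow> a [^] (n::nat) \<otimes> (s \<otimes> x) \<in> K"
proof -
  define U where "U = {x \<in> carrier R. \<exists>m::nat. a [^] m \<otimes> x \<in> K}"
  interpret K: ideal K R by fact
  have "ideal U R"
  proof (rule idealI_cring)
    show "\<zero> \<in> U"
      using a by (auto simp: U_def)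
  next
    fix x y assume "x \<in> U" "y \<in> U"
    then obtain k m :: nat where xy: "x \<in> carrier R" "a [^] k \<otimes> x \<in> K"
        "y \<in> carrier R" "a [^] m \<otimes> y \<in> K"
      by (auto simp: U_def)
    have "a [^] (k + m) \<otimes> x \<in> K" "a [^] (k + m) \<otimes> y \<in> K"
      using nat_pow_mult_mem_mono[OF K a] xy by (meson le_add1 le_add2)+
    then have "a [^] (k + m) \<otimes> (x \<oplus> y) \<in> K"
      using xy a by (simp add: r_distr)
    then show "x \<oplus> y \<in> U"
      using xy by (auto simp: U_def)
  next
    fix r x assume r: "r \<in> carrier R" and "x \<in> U"
    then obtain m :: nat where x: "x \<in> carrier R" "a [^] m \<otimes> x \<in> K"
      by (auto simp: U_def)
    have "a [^] m \<otimes> (r \<otimes> x) = r \<otimes> (a [^] m \<otimes> x)"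
      using a r x by (simp add: m_lcomm)
    also have "\<dots> \<in> K"
      using r x by (blast intro: K.I_l_closed)
    finally show "r \<otimes> x \<in> U"
      using r x by (auto simp: U_def)
  qed (auto simp: U_def)
  then obtain s J where sJ: "s \<in> S" "fin_gen_ideal R J" "s <# U \<subseteq> J" "J \<subseteq> U"
    using noeth unfolding S_Noetherian_def by blast
  then obtain A where A: "A \<subseteq> carrier R" "finite A" "J = Idl A"
    unfolding fin_gen_ideal_def by blast
  have "\<forall>x\<in>A. \<exists>m::nat. a [^] m \<otimes> x \<in> K"
    using A sJ(4) genideal_self[OF A(1)] by (auto simp: U_def)
  then obtain f :: "'a \<Rightarrow> nat" where f: "\<And>x. x \<in> A \<Longrightarrow> a [^] f x \<otimes> x \<in> K"
    by metis
  \<comment> \<open>For \<open>A = {}\<close> the maximum is unspecified, but then any exponent works.\<close>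
  define n where "n = Max (f ` A)"
  have "A \<subseteq> {x \<in> carrier R. a [^] n \<otimes> x \<in> K}"
    using nat_pow_mult_mem_mono[OF K a _ f, of _ n] A by (auto simp: n_def)
  then have J: "J \<subseteq> {x \<in> carrier R. a [^] n \<otimes> x \<in> K}"
    unfolding A(3) using a by (intro genideal_minimal colon_ideal K) auto
  show ?thesis
  proof (rule that[OF sJ(1), of n])
    fix x and m :: nat assume "x \<in> carrier R" "a [^] m \<otimes> x \<in> K"
    then have "s \<otimes> x \<in> J"
      using sJ(3) by (auto simp: U_def l_coset_def)
    then show "a [^] n \<otimes> (s \<otimes> x) \<in> K" using J by blast
  qed
qed


section \<open>Ideals with bounded trace on a principal ideal\<close>

text \<open>When \<open>b \<noteq> 0\<close> in a domain, this says that \<open>b I \<subseteq> K\<close> and that, after inverting \<open>S\<close>, the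
  intersection of \<open>K\<close> with the principal ideal of \<open>b\<close> is no larger than \<open>b I\<close>.\<close>

definition bounded_trace :: "('a, 'b) ring_scheme \<Rightarrow> 'a set \<Rightarrow> 'a set \<Rightarrow> 'a \<Rightarrow> 'a set \<Rightarrow> bool" where
  "bounded_trace R S I b K \<longleftrightarrow>
     ideal K R \<and>
     (\<forall>i\<in>I. b \<otimes>\<^bsub>R\<^esub> i \<in> K) \<and>
     (\<forall>y\<in>carrier R. b \<otimes>\<^bsub>R\<^esub> y \<in> K \<longrightarrow> (\<exists>s\<in>S. s \<otimes>\<^bsub>R\<^esub> y \<in> I))"

text \<open>Cancelling \<open>b\<close> in \<open>b y = b i\<close> shows that the smallest candidate \<open>b I\<close> satisfies the bound
  with \<open>s = 1\<close>.\<close>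

lemma (in domain) bounded_trace_scaled_ideal:
  assumes I: "ideal I R" and b: "b \<in> carrier R" "b \<noteq> \<zero>" and one: "\<one> \<in> S"
  shows "bounded_trace R S I b (b <# I)"
proof -
  interpret I: ideal I R by fact
  have "ideal (b <# I) R"
  proof (rule idealI_cring)
    fix x y assume "x \<in> b <# I" "y \<in> b <# I"
    then obtain i j where ij: "x = b \<otimes> i" "y = b \<otimes> j" "i \<in> I" "j \<in> I"
      by (auto simp: l_coset_def)
    then have "x \<oplus> y = b \<otimes> (i \<oplus> j)"
      using b by (simp add: r_distr)
    then show "x \<oplus> y \<in> b <# I"
      using ij by (auto simp: l_coset_def)
  next
    fix r x assume r: "r \<in> carrier R" and "x \<in> b <# I"
    then obtain i where i: "x = b \<otimes> i" "i \<in> I"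
      by (auto simp: l_coset_def)
    then have "r \<otimes> x = b \<otimes> (r \<otimes> i)"
      using b r by (simp add: m_lcomm)
    then show "r \<otimes> x \<in> b <# I"
      using i r I.I_l_closed by (auto simp: l_coset_def)
  next
    have "\<zero> = b \<otimes> \<zero>" using b by simp
    then show "\<zero> \<in> b <# I"
      using I.zero_closed unfolding l_coset_def by blast
  qed (use b in \<open>auto simp: l_coset_def\<close>)
  moreover have "\<one> \<otimes> y \<in> I" if "y \<in> carrier R" "b \<otimes> y \<in> b <# I" for y
    using that b m_lcancel[OF b(2,1)] by (auto simp: l_coset_def)
  ultimately show ?thesis
    using one unfolding bounded_trace_def by (blast intro: l_coset_def[THEN equalityD2, THEN subsetD])
qed

text \<open>If \<open>b y = k + a\<^sup>n r\<close> with \<open>k \<in> K\<close>, then multiplication by \<open>a\<close> sends the left-hand side into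
  \<open>b I \<subseteq> K\<close>, so \<open>a\<^sup>n\<^sup>+\<^sup>1 r \<in> K\<close>. When \<open>n\<close> is the exponent at which the colon ideals \<open>K : a\<^sup>m\<close>
  stabilize up to a factor \<open>s\<close>, already \<open>a\<^sup>n s r \<in> K\<close>, whence \<open>b (s y) \<in> K\<close>.\<close>

lemma (in cring) bounded_trace_add_power:
  assumes noeth: "S_Noetherian R S" and S: "submonoid S R" and I: "ideal I R"
    and b: "b \<in> carrier R" and a: "a \<in> I" and K: "bounded_trace R S I b K"
  obtains n :: nat where "bounded_trace R S I b (K <+> PIdl (a [^] n))"
proof -
  interpret S: submonoid S R by fact
  interpret I: ideal I R by fact
  have idK: "ideal K R" and bI: "\<And>i. i \<in> I \<Longrightarrow> b \<otimes> i \<in> K"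
    and trace: "\<And>y. y \<in> carrier R \<Longrightarrow> b \<otimes> y \<in> K \<Longrightarrow> \<exists>s\<in>S. s \<otimes> y \<in> I"
    using K unfolding bounded_trace_def by auto
  interpret K: ideal K R by fact
  have ac: "a \<in> carrier R" using a by simp
  obtain s and n :: nat where s: "s \<in> S"
    and stab: "\<And>x m. x \<in> carrier R \<Longrightarrow> a [^] (m::nat) \<otimes> x \<in> K \<Longrightarrow> a [^] n \<otimes> (s \<otimes> x) \<in> K"
    using S_Noetherian_colon_powers_stabilize[OF noeth S.subset idK ac] by blast
  have sc: "s \<in> carrier R" using s by (rule S.mem_carrier)
  define L :: "'a set" where "L = K <+> PIdl (a [^] n)"
  have P: "ideal (PIdl (a [^] n)) R"
    using ac by (intro cgenideal_ideal) simp
  have idL: "ideal L R" unfolding L_def by (intro add_ideals idK P)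
  have "b \<otimes> i \<in> L" if "i \<in> I" for i
  proof -
    have "b \<otimes> i = b \<otimes> i \<oplus> \<zero>" using b that by simp
    moreover have "\<zero> \<in> PIdl (a [^] n)"
      using P by (simp add: additive_subgroup.zero_closed ideal.axioms(1))
    ultimately show ?thesis
      using bI[OF that] unfolding L_def set_add_def' by blast
  qed
  moreover have "\<exists>t\<in>S. t \<otimes> y \<in> I" if y: "y \<in> carrier R" and byL: "b \<otimes> y \<in> L" for y
  proof -
    obtain k r where kr: "b \<otimes> y = k \<oplus> r \<otimes> a [^] n" "k \<in> K" "r \<in> carrier R"
      using byL unfolding L_def set_add_def' cgenideal_def by blast
    have kc: "k \<in> carrier R" using kr by simp
    \<comment> \<open>Multiplying by \<open>a\<close> raises the exponent of \<open>a\<close> and makes the left-hand side lie in \<open>b I\<close>.\<close>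
    have "b \<otimes> (a \<otimes> y) = a \<otimes> (k \<oplus> r \<otimes> a [^] n)"
      using ac b y by (simp add: kr(1)[symmetric] m_lcomm)
    also have "\<dots> = a \<otimes> k \<oplus> a [^] Suc n \<otimes> r"
      using ac kr(3) kc by (simp add: r_distr m_ac)
    finally have eq: "b \<otimes> (a \<otimes> y) = a \<otimes> k \<oplus> a [^] Suc n \<otimes> r" .
    have "a [^] Suc n \<otimes> r = b \<otimes> (a \<otimes> y) \<oplus> (\<ominus> \<one>) \<otimes> (a \<otimes> k)"
      unfolding eq using ac kr(3) kc
      by (simp add: l_minus a_comm r_neg1)
    moreover have "b \<otimes> (a \<otimes> y) \<in> K"
      using a y by (intro bI I.I_r_closed)
    moreover have "(\<ominus> \<one>) \<otimes> (a \<otimes> k) \<in> K"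
      using ac kr(2) by (intro K.I_l_closed) auto
    ultimately have "a [^] Suc n \<otimes> r \<in> K"
      using ideal_sum_closed[OF idK] by metis
    then have "a [^] n \<otimes> (s \<otimes> r) \<in> K"
      using kr(3) by (intro stab)
    \<comment> \<open>Multiplying instead by \<open>s\<close> keeps the exponent \<open>n\<close>, where the colon ideals are stable.\<close>
    moreover have "b \<otimes> (s \<otimes> y) = s \<otimes> k \<oplus> a [^] n \<otimes> (s \<otimes> r)"
    proof -
      have "b \<otimes> (s \<otimes> y) = s \<otimes> (k \<oplus> r \<otimes> a [^] n)"
        using sc b y by (simp add: kr(1)[symmetric] m_lcomm)
      also have "\<dots> = s \<otimes> k \<oplus> a [^] n \<otimes> (s \<otimes> r)"
        using sc kc kr(3) ac by (simp add: r_distr m_ac)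
      finally show ?thesis .
    qed
    ultimately have "b \<otimes> (s \<otimes> y) \<in> K"
      using sc kr(2) ideal_sum_closed[OF idK] K.I_l_closed by metis
    then obtain s' where s': "s' \<in> S" "s' \<otimes> (s \<otimes> y) \<in> I"
      using trace[of "s \<otimes> y"] sc y by auto
    have "(s' \<otimes> s) \<otimes> y = s' \<otimes> (s \<otimes> y)"
      using s' sc y by (simp add: m_assoc S.mem_carrier)
    then show ?thesis
      using s s' S.m_closed by metis
  qed
  ultimately have "bounded_trace R S I b L"
    using idL unfolding bounded_trace_def by blast
  then show ?thesis unfolding L_def by (rule that)
qed

text \<open>The generators can be treated one at a time: adjoining a power of a further generator
  \<open>a\<close> to an ideal that contains a power of \<open>J\<close> gives an ideal that contains a power of \<open>J + (a)\<close>.\<close>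

lemma (in domain) bounded_trace_contains_power:
  assumes noeth: "S_Noetherian R S" and S: "submonoid S R" and I: "ideal I R"
    and b: "b \<in> carrier R" "b \<noteq> \<zero>" and A: "finite A" "A \<subseteq> I"
  obtains K N where "bounded_trace R S I b K" "ideal_power R (Idl A) N \<subseteq> K"
proof -
  have "\<exists>K N. bounded_trace R S I b K \<and> ideal_power R (Idl A) N \<subseteq> K"
    using A
  proof (induction A rule: finite_induct)
    case empty
    have tr: "bounded_trace R S I b (b <# I)"
      using I b submonoid.one_closed[OF S] by (rule bounded_trace_scaled_ideal)
    then have id: "ideal (b <# I) R"
      unfolding bounded_trace_def by blast
    have "ideal_power R (Idl {}) (Suc 0) \<subseteq> Idl {}"
      unfolding ideal_power_Suc ideal_power_0
      using ideal_prod_inter[OF oneideal genideal_ideal[of "{}"]] by blast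
    also have "Idl {} \<subseteq> b <# I"
      using id by (intro genideal_minimal) auto
    finally show ?case using tr by blast
  next
    case (insert a A)
    then obtain K N where K: "bounded_trace R S I b K" "ideal_power R (Idl A) N \<subseteq> K"
      by auto
    obtain n :: nat where n: "bounded_trace R S I b (K <+> PIdl (a [^] n))"
      using bounded_trace_add_power[OF noeth S I b(1) _ K(1), of a] insert.prems by auto
    have sub: "A \<subseteq> carrier R" "a \<in> carrier R"
      using insert.prems ideal.Icarr[OF I] by auto
    note id = genideal_ideal[OF sub(1)] cgenideal_ideal[OF sub(2)]
    have "insert a A \<subseteq> Idl A <+> PIdl a"
    proof -
      have z: "\<zero> \<in> Idl A" "\<zero> \<in> PIdl a"
        using id by (simp_all add: additive_subgroup.zero_closed ideal.axioms(1))
      have "x \<in> Idl A <+> PIdl a" if "x \<in> A" for x :: 'a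
      proof -
        have "x = x \<oplus> \<zero>" using that sub by auto
        then show ?thesis
          using z(2) that genideal_self[OF sub(1)] unfolding set_add_def' by blast
      qed
      moreover have "a = \<zero> \<oplus> a" using sub by simp
      then have "a \<in> Idl A <+> PIdl a"
        using z(1) cgenideal_self[OF sub(2)] unfolding set_add_def' by blast
      ultimately show ?thesis by auto
    qed
    then have "Idl (insert a A) \<subseteq> Idl A <+> PIdl a"
      using id by (intro genideal_minimal add_ideals)
    then have "ideal_power R (Idl (insert a A)) (N + n) \<subseteq> ideal_power R (Idl A <+> PIdl a) (N + n)"
      by (rule ideal_power_mono)
    also have "\<dots> \<subseteq> ideal_power R (Idl A) N <+> ideal_power R (PIdl a) n"
      using id by (rule ideal_power_add_subset)
    also have "\<dots> \<subseteq> K <+> PIdl (a [^] n)"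
      using K(2) ideal_power_cgenideal_subset[OF sub(2), of n] unfolding set_add_def' by blast
    finally show ?case using n by blast
  qed
  then show ?thesis using that by blast
qed


section \<open>The intersection of the powers of an ideal\<close>

lemma (in domain) Inter_ideal_power_eq_zero:
  assumes noeth: "S_Noetherian R S" and S: "submonoid S R" and I: "ideal I R"
    and disj: "I \<inter> S = {}"
  shows "(\<Inter>n \<in> {1::nat..}. ideal_power R I n) = {\<zero>}"
proof (intro equalityI subsetI)
  fix b assume b: "b \<in> (\<Inter>n \<in> {1::nat..}. ideal_power R I n)"
  have bN: "b \<in> ideal_power R I N" for N
  proof (cases N)
    case 0
    have "b \<in> ideal_power R I 1" using b by blast
    then have "b \<in> carrier R"
      using ideal.Icarr[OF ideal_power_ideal[OF I]] by blast
    with 0 show ?thesis by (simp add: ideal_power_0)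
  next
    case (Suc n)
    then have "N \<in> {1..}" by simp
    then show ?thesis using b by blast
  qed
  have bc: "b \<in> carrier R"
    using bN[of 0] by (simp add: ideal_power_0)
  interpret S: submonoid S R by fact
  show "b \<in> {\<zero>}"
  proof (rule ccontr)
    assume "b \<notin> {\<zero>}"
    then have b0: "b \<noteq> \<zero>" by simp
    obtain s J where sJ: "s \<in> S" "fin_gen_ideal R J" "s <# I \<subseteq> J" "J \<subseteq> I"
      using noeth I unfolding S_Noetherian_def by blast
    then obtain A where A: "A \<subseteq> carrier R" "finite A" "J = Idl A"
      unfolding fin_gen_ideal_def by blast
    have AI: "A \<subseteq> I" using genideal_self[OF A(1)] A(3) sJ(4) by blast
    obtain K N where K: "bounded_trace R S I b K" "ideal_power R (Idl A) N \<subseteq> K"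
      using bounded_trace_contains_power[OF noeth S I bc b0 A(2) AI] by blast
    have sc: "s \<in> carrier R" using sJ(1) by (rule S.mem_carrier)
    have "s [^] N \<otimes> b \<in> ideal_power R J N"
      unfolding A(3) using genideal_ideal[OF A(1)] sc sJ(3)[unfolded A(3)] bN
      by (rule ideal_power_scale[OF I])
    then have "b \<otimes> s [^] N \<in> K"
      using K(2) A(3) bc sc by (auto simp: m_comm)
    \<comment> \<open>The trace bound is applied to the cofactor \<open>s\<^sup>N\<close> of \<open>b\<close>, so that \<open>b\<close> disappears.\<close>
    then obtain s' where s': "s' \<in> S" "s' \<otimes> s [^] N \<in> I"
      using K(1) sc unfolding bounded_trace_def by auto
    have "s [^] N \<in> S"
      by (induction N) (use sJ(1) in auto)
    then show False
      using disj s' by auto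
  qed
next
  fix x assume "x \<in> {\<zero>}"
  then show "x \<in> (\<Inter>n \<in> {1::nat..}. ideal_power R I n)"
    using ideal_power_ideal[OF I] by (auto simp: additive_subgroup.zero_closed ideal.axioms(1))
qed

theorem theorem4p5:
  fixes R :: "('a, 'b) ring_scheme" and S I B :: "'a set"
  assumes "domain R"
    and "mult_closed_subset R S"
    and "S_Noetherian R S"
    and "ideal I R"
    and "I \<inter> S = {}"
    and "B = (\<Inter>n \<in> {1::nat..}. ideal_power R I n)"
  shows "\<exists>t \<in> S. t <#\<^bsub>R\<^esub> B = {\<zero>\<^bsub>R\<^esub>}"
proof -
  interpret domain R by fact
  have S: "submonoid S R"
    using assms(2) unfolding mult_closed_subset_def by blast
  have "B = {\<zero>\<^bsub>R\<^esub>}"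
    unfolding assms(6) using assms(3) S assms(4,5) by (rule Inter_ideal_power_eq_zero)
  then have "\<one>\<^bsub>R\<^esub> <#\<^bsub>R\<^esub> B = {\<zero>\<^bsub>R\<^esub>}"
    by (simp add: l_coset_def)
  then show ?thesis
    using submonoid.one_closed[OF S] by blast
qed

end
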